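(* It is not true that for every symmetric (associative, unital) ring $R$, every idempotent $e\in R$ and all $a,b,c\in R$, the equality $e=abc$ implies $e=acb$. That is, there exist a symmetric ring $R$ with unity, an idempotent $e\in R$ and elements $a,b,c\in R$ such that $abc=e$ but $acb\neq e$.
   Context: A ring $R$ is symmetric if, for all $a,b,c\in R$, $abc=0$ implies $acb=0$. An idempotent is an element $e$ with $e^2=e$. *)

theory Defs
  imports "HOL-Algebra.Ring"
begin

locale symmetric_ring = ring R for R (structure) +
  assumes symmetric:
    "\<lbrakk>a \<in> carrier R; b \<in> carrier R; c \<in> carrier R; a \<otimes> b \<otimes> c = \<zero>\<rbrakk>
      \<Longrightarrow> a \<otimes> c \<otimes> b = \<zero>"

definition idempotent_elem :: "('a, 'm) ring_scheme \<Rightarrow> 'a \<Rightarrow> bool"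
  where "idempotent_elem R e \<longleftrightarrow> e \<in> carrier R \<and> e \<otimes>\<^bsub>R\<^esub> e = e"

end

theory Submission
  imports Defs "HOL-Algebra.Weak_Morphisms" "HOL-Library.Countable"
begin

text \<open>
  A ring without zero divisors is symmetric for a trivial reason: in it, \<open>abc = 0\<close> forces one of
  the factors, and hence also \<open>acb\<close>, to vanish. So it suffices to find such a ring with two
  units \<open>b\<close> and \<open>c\<close> that do not commute: the element \<open>a = (bc)\<inverse>\<close> gives \<open>abc = 1\<close>, an idempotent,
  whereas \<open>acb = 1\<close> would give \<open>cb = bc\<close>.

  Hamilton's quaternions with integer coordinates (the Lipschitz quaternions) are such a ring.
  They have no zero divisors because the norm \<open>x\<^sub>0\<^sup>2 + x\<^sub>1\<^sup>2 + x\<^sub>2\<^sup>2 + x\<^sub>3\<^sup>2\<close> is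
  multiplicative (Euler's four-square identity) and vanishes only at zero, and the units
  \<open>b = i\<close>, \<open>c = j\<close> anticommute. With \<open>a = -k\<close> one gets \<open>abc = 1\<close> and \<open>acb = -1\<close>.
  Integer rather than real coordinates keep the ring countable, so that it has an isomorphic
  copy whose elements are natural numbers.
\<close>

type_synonym quat = "int \<times> int \<times> int \<times> int"

fun quat_mult :: "quat \<Rightarrow> quat \<Rightarrow> quat" where
  "quat_mult (x0, x1, x2, x3) (y0, y1, y2, y3) =
    (x0 * y0 - x1 * y1 - x2 * y2 - x3 * y3,
     x0 * y1 + x1 * y0 + x2 * y3 - x3 * y2,
     x0 * y2 - x1 * y3 + x2 * y0 + x3 * y1,
     x0 * y3 + x1 * y2 - x2 * y1 + x3 * y0)"

fun quat_add :: "quat \<Rightarrow> quat \<Rightarrow> quat" where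
  "quat_add (x0, x1, x2, x3) (y0, y1, y2, y3) = (x0 + y0, x1 + y1, x2 + y2, x3 + y3)"

fun quat_norm :: "quat \<Rightarrow> int" where
  "quat_norm (x0, x1, x2, x3) = x0\<^sup>2 + x1\<^sup>2 + x2\<^sup>2 + x3\<^sup>2"

definition lipschitz_ring :: "quat ring" where
  "lipschitz_ring =
    \<lparr>carrier = UNIV, mult = quat_mult, one = (1, 0, 0, 0), zero = (0, 0, 0, 0), add = quat_add\<rparr>"

lemma lipschitz_ring_simps [simp]:
  "carrier lipschitz_ring = UNIV"
  "mult lipschitz_ring = quat_mult"
  "one lipschitz_ring = (1, 0, 0, 0)"
  "zero lipschitz_ring = (0, 0, 0, 0)"
  "add lipschitz_ring = quat_add"
  by (simp_all add: lipschitz_ring_def)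

lemma quat_mult_assoc: "quat_mult (quat_mult x y) z = quat_mult x (quat_mult y z)"
  by (cases x; cases y; cases z) (simp add: algebra_simps)

lemma quat_mult_add_left: "quat_mult (quat_add x y) z = quat_add (quat_mult x z) (quat_mult y z)"
  by (cases x; cases y; cases z) (simp add: algebra_simps)

lemma quat_mult_add_right: "quat_mult z (quat_add x y) = quat_add (quat_mult z x) (quat_mult z y)"
  by (cases x; cases y; cases z) (simp add: algebra_simps)

lemma quat_add_left_inverse: "\<exists>y. quat_add y x = (0, 0, 0, 0)"
proof (cases x)
  case (fields x0 x1 x2 x3)
  then have "quat_add (- x0, - x1, - x2, - x3) x = (0, 0, 0, 0)" by simp
  then show ?thesis by blast
qed

lemma abelian_group_lipschitz_ring: "abelian_group lipschitz_ring"
proof (rule abelian_groupI)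
  fix x y z
  show "x \<oplus>\<^bsub>lipschitz_ring\<^esub> y \<oplus>\<^bsub>lipschitz_ring\<^esub> z =
      x \<oplus>\<^bsub>lipschitz_ring\<^esub> (y \<oplus>\<^bsub>lipschitz_ring\<^esub> z)"
    by (cases x; cases y; cases z) simp
  show "x \<oplus>\<^bsub>lipschitz_ring\<^esub> y = y \<oplus>\<^bsub>lipschitz_ring\<^esub> x"
    by (cases x; cases y) simp
  show "\<zero>\<^bsub>lipschitz_ring\<^esub> \<oplus>\<^bsub>lipschitz_ring\<^esub> x = x"
    by (cases x) simp
  show "\<exists>y \<in> carrier lipschitz_ring. y \<oplus>\<^bsub>lipschitz_ring\<^esub> x = \<zero>\<^bsub>lipschitz_ring\<^esub>"
    using quat_add_left_inverse by simp
qed simp_all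

lemma monoid_lipschitz_ring: "monoid lipschitz_ring"
proof (rule monoidI)
  fix x
  show "\<one>\<^bsub>lipschitz_ring\<^esub> \<otimes>\<^bsub>lipschitz_ring\<^esub> x = x"
    and "x \<otimes>\<^bsub>lipschitz_ring\<^esub> \<one>\<^bsub>lipschitz_ring\<^esub> = x"
    by (cases x; simp)+
qed (simp_all add: quat_mult_assoc)

lemma ring_lipschitz_ring: "ring lipschitz_ring"
  by (rule ringI)
    (simp_all add: abelian_group_lipschitz_ring monoid_lipschitz_ring
      quat_mult_add_left quat_mult_add_right)

lemma quat_norm_mult: "quat_norm (quat_mult x y) = quat_norm x * quat_norm y"
  by (cases x; cases y) (simp add: power2_eq_square algebra_simps)

lemma quat_norm_eq_0_iff: "quat_norm x = 0 \<longleftrightarrow> x = (0, 0, 0, 0)"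
  by (cases x) (simp add: add_nonneg_eq_0_iff)

lemma quat_mult_eq_0_iff:
  "quat_mult x y = (0, 0, 0, 0) \<longleftrightarrow> x = (0, 0, 0, 0) \<or> y = (0, 0, 0, 0)"
  by (simp only: quat_norm_eq_0_iff[symmetric] quat_norm_mult mult_eq_0_iff)

lemma symmetric_ring_if_no_zero_divisors:
  fixes R (structure)
  assumes "ring R"
    and integral: "\<And>x y. \<lbrakk>x \<in> carrier R; y \<in> carrier R; x \<otimes> y = \<zero>\<rbrakk> \<Longrightarrow> x = \<zero> \<or> y = \<zero>"
  shows "symmetric_ring R"
proof -
  interpret ring R by fact
  show ?thesis
  proof
    fix a b c
    assume carr: "a \<in> carrier R" "b \<in> carrier R" "c \<in> carrier R" and "a \<otimes> b \<otimes> c = \<zero>"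
    then have "a = \<zero> \<or> b = \<zero> \<or> c = \<zero>"
      using integral by blast
    then show "a \<otimes> c \<otimes> b = \<zero>"
      using carr by auto
  qed
qed

lemma symmetric_ring_image_ring:
  fixes R (structure)
  assumes "symmetric_ring R" and inj: "inj_on f (carrier R)"
  shows "symmetric_ring (image_ring f R)"
proof -
  interpret symmetric_ring R by fact
  have iso: "f \<in> ring_iso R (image_ring f R)"
    by (rule inj_imp_image_ring_iso[OF inj])
  have ring: "ring (image_ring f R)"
    using ring_iso_imp_img_ring[OF iso] by (simp add: image_ring_zero[of f R, symmetric])
  note mult = ring_iso_memE(2)[OF iso, symmetric]
  show ?thesis
  proof (rule symmetric_ring.intro[OF ring], unfold_locales)
    fix a b c
    assume "a \<in> carrier (image_ring f R)" "b \<in> carrier (image_ring f R)"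
      "c \<in> carrier (image_ring f R)"
    then obtain x y z where abc: "a = f x" "b = f y" "c = f z"
      and carr: "x \<in> carrier R" "y \<in> carrier R" "z \<in> carrier R"
      by (auto simp: image_ring_carrier)
    assume "a \<otimes>\<^bsub>image_ring f R\<^esub> b \<otimes>\<^bsub>image_ring f R\<^esub> c = \<zero>\<^bsub>image_ring f R\<^esub>"
    then have "f (x \<otimes> y \<otimes> z) = f \<zero>"
      by (simp add: abc carr mult image_ring_zero)
    then have "x \<otimes> y \<otimes> z = \<zero>"
      using inj carr by (simp add: inj_on_eq_iff)
    then have "x \<otimes> z \<otimes> y = \<zero>"
      by (rule symmetric[OF carr])
    then show "a \<otimes>\<^bsub>image_ring f R\<^esub> c \<otimes>\<^bsub>image_ring f R\<^esub> b = \<zero>\<^bsub>image_ring f R\<^esub>"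
      by (simp add: abc carr mult image_ring_zero)
  qed
qed

theorem mainTheorem3:
  shows "\<exists>R :: nat ring. symmetric_ring R \<and>
    (\<exists>e a b c. idempotent_elem R e \<and>
      a \<in> carrier R \<and> b \<in> carrier R \<and> c \<in> carrier R \<and>
      a \<otimes>\<^bsub>R\<^esub> b \<otimes>\<^bsub>R\<^esub> c = e \<and> a \<otimes>\<^bsub>R\<^esub> c \<otimes>\<^bsub>R\<^esub> b \<noteq> e)"
proof -
  define f :: "quat \<Rightarrow> nat" where "f = to_nat"
  define R where "R = image_ring f lipschitz_ring"
  have inj: "inj f"
    by (simp add: f_def)
  have "symmetric_ring lipschitz_ring"
    by (rule symmetric_ring_if_no_zero_divisors[OF ring_lipschitz_ring])
      (simp add: quat_mult_eq_0_iff)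
  then have sym: "symmetric_ring R"
    unfolding R_def by (rule symmetric_ring_image_ring) (simp add: inj)
  have carr: "f x \<in> carrier R" for x
    by (simp add: R_def image_ring_carrier)
  have mult: "f x \<otimes>\<^bsub>R\<^esub> f y = f (quat_mult x y)" for x y
    using ring_iso_memE(2)[OF inj_imp_image_ring_iso, of f lipschitz_ring x y] inj
    by (simp add: R_def)
  let ?e = "f (1, 0, 0, 0)"
  let ?a = "f (0, 0, 0, - 1)" and ?b = "f (0, 1, 0, 0)" and ?c = "f (0, 0, 1, 0)"
  have "idempotent_elem R ?e"
    by (simp add: idempotent_elem_def carr mult)
  moreover have "?a \<otimes>\<^bsub>R\<^esub> ?b \<otimes>\<^bsub>R\<^esub> ?c = ?e"
    by (simp add: mult)
  moreover have "?a \<otimes>\<^bsub>R\<^esub> ?c \<otimes>\<^bsub>R\<^esub> ?b \<noteq> ?e"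
    using inj by (simp add: mult inj_eq)
  ultimately show ?thesis
    by (intro exI[of _ R] conjI sym exI[of _ ?e] exI[of _ ?a] exI[of _ ?b] exI[of _ ?c] carr)
qed

end
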